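(* Let $\varepsilon>0$ and let $I_{11},I_{22}>0$, $I_{13},I_{23}\in\mathbb{R}$ be entries of the inertia tensor. The (multivalued) discrete system $$\frac{4I_{11}u_{k+1}+2\varepsilon v_{k+1}(I_{13}u_{k+1}+I_{23}v_{k+1})}{4+\varepsilon^2(u_{k+1}^2+v_{k+1}^2)}=\frac{4I_{11}u_k-2\varepsilon v_k(I_{13}u_k+I_{23}v_k)}{4+\varepsilon^2(u_k^2+v_k^2)},$$ $$\frac{4I_{22}v_{k+1}-2\varepsilon u_{k+1}(I_{23}v_{k+1}+I_{13}u_{k+1})}{4+\varepsilon^2(u_{k+1}^2+v_{k+1}^2)}=\frac{4I_{22}v_k+2\varepsilon u_k(I_{23}v_k+I_{13}u_k)}{4+\varepsilon^2(u_k^2+v_k^2)}$$ evolves on the level sets of the rational function $$R(u,v)=\frac{4(I_{11}u^2+I_{22}v^2)\left(4I_{11}I_{22}+\varepsilon^2(I_{13}u+I_{23}v)^2\right)}{\left(4+\varepsilon^2(u^2+v^2)\right)^2},$$ i.e. $R(u_{k+1},v_{k+1})=R(u_k,v_k)$ for any successive points $(u_k,v_k)$, $(u_{k+1},v_{k+1})$ of the system.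
   Context: The numbers $I_{ij}$ are entries of a symmetric positive definite $3\times3$ inertia tensor with $I_{12}=0$. The system is the reduced discrete dynamics, in the coordinates $(u,v)$, of a discretisation of the nonholonomic Suslov problem with time step $\varepsilon$. Given $(u_k,v_k)$ there may be several (real or complex) solutions $(u_{k+1},v_{k+1})$; the result applies to all branches (at points where the denominators do not vanish). *)

theory Defs
  imports "HOL-Analysis.Analysis"
begin

definition inertia_tensor :: "real^3^3 \<Rightarrow> bool" where
  "inertia_tensor J \<longleftrightarrow> transpose J = J \<and> (\<forall>x. x \<noteq> 0 \<longrightarrow> 0 < x \<bullet> (J *v x)) \<and> J $ 1 $ 2 = 0"

text \<open>
  Positive definiteness puts no constraint on the four entries that occur in the system beyond
  positivity of the first two.
\<close>

lemma inertia_tensor_entries: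
  fixes a b p q :: real
  shows "(\<exists>J. inertia_tensor J \<and> J $ 1 $ 1 = a \<and> J $ 2 $ 2 = b \<and> J $ 1 $ 3 = p \<and> J $ 2 $ 3 = q)
    \<longleftrightarrow> 0 < a \<and> 0 < b"
proof
  assume "\<exists>J. inertia_tensor J \<and> J $ 1 $ 1 = a \<and> J $ 2 $ 2 = b \<and> J $ 1 $ 3 = p \<and> J $ 2 $ 3 = q"
  then obtain J where J: "inertia_tensor J" "J $ 1 $ 1 = a" "J $ 2 $ 2 = b" by blast
  have "axis i 1 \<bullet> (J *v axis i 1) = J $ i $ i" for i
    by (simp add: inner_axis' matrix_vector_mult_basis column_def)
  moreover have "axis i (1::real) \<noteq> 0" for i :: 3
    by (simp add: axis_eq_0_iff)
  ultimately show "0 < a \<and> 0 < b"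
    using J unfolding inertia_tensor_def by metis
next
  assume ab: "0 < a \<and> 0 < b"
  define J :: "real^3^3" where
    "J = vector [vector [a, 0, p], vector [0, b, q], vector [p, q, p\<^sup>2 / a + q\<^sup>2 / b + 1]]"
  have "0 < x \<bullet> (J *v x)" if "x \<noteq> 0" for x
  proof -
    have eq: "x \<bullet> (J *v x) = a * (x$1 + p * x$3 / a)\<^sup>2 + b * (x$2 + q * x$3 / b)\<^sup>2 + (x$3)\<^sup>2"
      using ab by (simp add: J_def inner_vec_def matrix_vector_mult_def sum_3 vector_3
          field_simps power2_eq_square)
    show ?thesis
    proof (cases "x$3 = 0")
      case True
      then have "x$1 \<noteq> 0 \<or> x$2 \<noteq> 0"
        using that by (auto simp: vec_eq_iff forall_3)
      then show ?thesis
        unfolding eq using ab True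
        by (auto intro: add_pos_nonneg add_nonneg_pos)
    next
      case False
      then show ?thesis
        unfolding eq using ab by (intro add_nonneg_pos) auto
    qed
  qed
  moreover have "transpose J = J"
    by (simp add: J_def transpose_def vec_eq_iff forall_3 vector_3)
  ultimately have "inertia_tensor J"
    by (simp add: inertia_tensor_def J_def vector_3)
  then show "\<exists>J. inertia_tensor J \<and> J $ 1 $ 1 = a \<and> J $ 2 $ 2 = b \<and> J $ 1 $ 3 = p \<and> J $ 2 $ 3 = q"
    by (intro exI[of _ J]) (simp add: J_def vector_3)
qed

definition suslov_denom :: "real \<Rightarrow> complex \<Rightarrow> complex \<Rightarrow> complex" where
  "suslov_denom \<epsilon> u v = 4 + of_real \<epsilon> ^ 2 * (u ^ 2 + v ^ 2)"

text \<open>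
  The system is multivalued, so it is a relation between the point \<open>(u, v)\<close> and any of its
  successors \<open>(u', v')\<close>. The equations have no meaning where a denominator vanishes, and such
  points are excluded here rather than left to division by zero.
\<close>

definition suslov_step ::
  "real \<Rightarrow> real^3^3 \<Rightarrow> complex \<times> complex \<Rightarrow> complex \<times> complex \<Rightarrow> bool" where
  "suslov_step \<epsilon> J = (\<lambda>(u, v) (u', v').
     let I11 = of_real (J $ 1 $ 1); I22 = of_real (J $ 2 $ 2);
         I13 = of_real (J $ 1 $ 3); I23 = of_real (J $ 2 $ 3); e = of_real \<epsilon>
     in suslov_denom \<epsilon> u v \<noteq> 0 \<and> suslov_denom \<epsilon> u' v' \<noteq> 0 \<and>
        (4 * I11 * u' + 2 * e * v' * (I13 * u' + I23 * v')) / suslov_denom \<epsilon> u' v'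
          = (4 * I11 * u - 2 * e * v * (I13 * u + I23 * v)) / suslov_denom \<epsilon> u v \<and>
        (4 * I22 * v' - 2 * e * u' * (I23 * v' + I13 * u')) / suslov_denom \<epsilon> u' v'
          = (4 * I22 * v + 2 * e * u * (I23 * v + I13 * u)) / suslov_denom \<epsilon> u v)"

definition suslov_R :: "real \<Rightarrow> real^3^3 \<Rightarrow> complex \<times> complex \<Rightarrow> complex" where
  "suslov_R \<epsilon> J = (\<lambda>(u, v).
     let I11 = of_real (J $ 1 $ 1); I22 = of_real (J $ 2 $ 2);
         I13 = of_real (J $ 1 $ 3); I23 = of_real (J $ 2 $ 3); e = of_real \<epsilon>
     in 4 * (I11 * u ^ 2 + I22 * v ^ 2) * (4 * I11 * I22 + e ^ 2 * (I13 * u + I23 * v) ^ 2)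
          / (suslov_denom \<epsilon> u v) ^ 2)"

end

(* With w = I13 u + I23 v, the numerators A = 4 I11 u +- 2 e v w and B = 4 I22 v -+ 2 e u w of the
   two equations satisfy
     I22 A^2 + I11 B^2 = 4 (I11 u^2 + I22 v^2) (4 I11 I22 + e^2 w^2)
   for either choice of sign, because the cross terms cancel. Hence R is the same quadratic form
   I22 X^2 + I11 Y^2 evaluated at the two left-hand sides and at the two right-hand sides. *)

theory Submission
  imports Defs
begin

text \<open>Here \<open>e\<close> is an arbitrary field element, not a positive time step, so that
  the instance \<open>- e\<close> covers the opposite signs on the right-hand sides of the
  system.\<close>

lemma suslov_quadratic_form:
  fixes a b p q e u v d :: "'a::field"
  shows "4 * (a * u ^ 2 + b * v ^ 2) * (4 * a * b + e ^ 2 * (p * u + q * v) ^ 2) / d ^ 2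
    = b * ((4 * a * u + 2 * e * v * (p * u + q * v)) / d) ^ 2
      + a * ((4 * b * v - 2 * e * u * (q * v + p * u)) / d) ^ 2"
proof -
  have "4 * (a * u ^ 2 + b * v ^ 2) * (4 * a * b + e ^ 2 * (p * u + q * v) ^ 2)
    = b * (4 * a * u + 2 * e * v * (p * u + q * v)) ^ 2
      + a * (4 * b * v - 2 * e * u * (q * v + p * u)) ^ 2"
    by algebra
  then show ?thesis
    by (simp only: power_divide times_divide_eq_right add_divide_distrib [symmetric])
qed

theorem proposition7p1:
  fixes \<epsilon> :: real and J :: "real^3^3" and u v u' v' :: complex
  assumes "0 < \<epsilon>"
    and "inertia_tensor J"
    and "suslov_step \<epsilon> J (u, v) (u', v')"
  shows "suslov_R \<epsilon> J (u', v') = suslov_R \<epsilon> J (u, v)"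
proof -
  define a b p q e :: complex where
    "a = of_real (J $ 1 $ 1)" and "b = of_real (J $ 2 $ 2)" and "p = of_real (J $ 1 $ 3)"
    and "q = of_real (J $ 2 $ 3)" and "e = of_real \<epsilon>"
  note entries = a_def [symmetric] b_def [symmetric] p_def [symmetric] q_def [symmetric]
    e_def [symmetric]
  let ?d = "suslov_denom \<epsilon>"
  have step: "(4 * a * u' + 2 * e * v' * (p * u' + q * v')) / ?d u' v'
      = (4 * a * u - 2 * e * v * (p * u + q * v)) / ?d u v"
    "(4 * b * v' - 2 * e * u' * (q * v' + p * u')) / ?d u' v'
      = (4 * b * v + 2 * e * u * (q * v + p * u)) / ?d u v"
    using assms(3) by (simp_all add: suslov_step_def Let_def entries)
  have "suslov_R \<epsilon> J (u', v')
    = b * ((4 * a * u' + 2 * e * v' * (p * u' + q * v')) / ?d u' v') ^ 2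
      + a * ((4 * b * v' - 2 * e * u' * (q * v' + p * u')) / ?d u' v') ^ 2"
    by (simp only: suslov_R_def Let_def prod.case entries suslov_quadratic_form)
  also have "\<dots> = b * ((4 * a * u - 2 * e * v * (p * u + q * v)) / ?d u v) ^ 2
      + a * ((4 * b * v + 2 * e * u * (q * v + p * u)) / ?d u v) ^ 2"
    by (simp only: step)
  also have "\<dots> = suslov_R \<epsilon> J (u, v)"
    \<comment> \<open>Replacing \<open>e\<close> by \<open>- e\<close> turns the numerators of the
      left-hand sides into those of the right-hand sides; the closed form of R keeps its value
      because it contains only \<open>e ^ 2\<close>.\<close>
    using suslov_quadratic_form [of a u b v "- e" p q "?d u v"]
    by (simp add: suslov_R_def Let_def entries)
  finally show ?thesis .
qed

end
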